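(* Let $f:\mathbb{R}^n\to\mathbb{R}$ be continuously differentiable, with global minimum value $f_{\mathrm{low}}:=\min_{x\in\mathbb{R}^n}f(x)$, and assume there exists $\mu_c>0$ such that $f(y)\ge f(x)+\nabla f(x)^T(y-x)+\frac{\mu_c}{2}\|y-x\|^2$ for all $x,y\in\mathbb{R}^n$. Consider a run of the trust-region algorithm described in the context. Assume there is $L\ge 1$ with $|f(x_k+s_k)-m_k(s_k)|\le \tfrac12(L+\|B_k\|)\|s_k\|^2$ for all $k\in\mathbb{N}$, and that there exist $\mu>0$ and $0\le p\le 1$ such that $\max_{j=0,\ldots,k}\|B_j\|\le \mu(1+|\mathcal{S}_{k-1}|^p)$ for all $k\in\mathbb{N}$. Assume that the algorithm generates infinitely many successful iterations. Define $$\kappa_0:=\frac{\psi_\beta(2\mu)}{\eta_1\kappa_{\mathrm{mdc}}a_{\min}},\qquad \kappa_2:=\frac{\psi_\beta(2\mu)}{\psi_\beta(\mu)}.$$ Let $\delta_k:=f(x_k)-f_{\mathrm{low}}$, let $\epsilon>0$, let $\widehat{k}_\epsilon$ be the first iteration such that $\delta_{\widehat{k}_\epsilon}>\epsilon$ and $\delta_{\widehat{k}_\epsilon+1}\le\epsilon$, and let $\widehat{\mathcal{S}}(\epsilon):=\{k\in\mathcal{S}\mid k<\widehat{k}_\epsilon\}$. If $p=0$, then $|\widehat{\mathcal{S}}(\epsilon)|\le\frac{\kappa_0}{2\mu_c}\log\left(\frac{\delta_0}{\epsilon}\right)=O(\log(\epsilon^{-1}))$. If $0<p<1$, then $$|\widehat{\mathcal{S}}(\epsilon)|\le\left[(1-p)\left(\frac{\kappa_0}{2\mu_c}\log\left(\frac{\delta_0}{\epsilon}\right)-\kappa_2\right)+1\right]^{1/(1-p)}=O\left(\left[(1-p)\log(\epsilon^{-1})\right]^{1/(1-p)}\right).$$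 If $p=1$, then $$|\widehat{\mathcal{S}}(\epsilon)|\le\exp\left(\frac{\kappa_0}{2\mu_c}\log\left(\frac{\delta_0}{\epsilon}\right)-\kappa_2\right)=O\left(\epsilon^{-\frac{\kappa_0}{2\mu_c}}\right).$$
   Context: $\|\cdot\|$ is the Euclidean norm for vectors and the induced norm for matrices; $\mathbb{N}=\{0,1,2,\ldots\}$; by convention $0^0=1$; $|\mathcal A|$ is the cardinality of a finite set. Trust-region algorithm. Fix constants $0<\eta_1\le\eta_2<1$, $0<\gamma_1\le\gamma_2<1\le\gamma_3\le\gamma_4$, $0<\kappa_{\mathrm{mdc}}\le\frac12$, $-1\le\alpha\le1$, $0\le\beta\le1$, $x_0\in\mathbb{R}^n$, $\Delta_0>0$. For $k=0,1,\ldots$: choose a symmetric $B_k\in\mathbb{R}^{n\times n}$ and set $m_k(s):=f(x_k)+\nabla f(x_k)^Ts+\frac12 s^TB_ks$ and $r_k:=\frac{\|\nabla f(x_k)\|^\alpha}{(1+\|B_k\|)^\beta}\Delta_k$. Let $s_{k,\mathrm{cp}}:=-t_k\nabla f(x_k)$, where $t_k$ minimizes $m_k(-t\nabla f(x_k))$ over $t\ge0$ with $\|t\nabla f(x_k)\|\le r_k$. Compute any $s_k$ with $\|s_k\|\le r_k$ and $m_k(0)-m_k(s_k)\ge2\kappa_{\mathrm{mdc}}(m_k(0)-m_k(s_{k,\mathrm{cp}}))$. Let $\rho_k:=\frac{f(x_k)-f(x_k+s_k)}{m_k(0)-m_k(s_k)}$. If $\rho_k\ge\eta_1$, set $x_{k+1}:=x_k+s_k$;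 otherwise $x_{k+1}:=x_k$. Choose $\Delta_{k+1}\in[\gamma_3\Delta_k,\gamma_4\Delta_k]$ if $\rho_k\ge\eta_2$; $\Delta_{k+1}\in[\gamma_2\Delta_k,\Delta_k]$ if $\eta_1\le\rho_k<\eta_2$; $\Delta_{k+1}\in[\gamma_1\Delta_k,\gamma_2\Delta_k]$ if $\rho_k<\eta_1$. Iteration $i$ is successful if $\rho_i\ge\eta_1$; $\mathcal{S}:=\{i\in\mathbb{N}\mid\rho_i\ge\eta_1\}$, $\mathcal{S}_k:=\{i\in\mathcal{S}\mid i\le k\}$, and $|\mathcal{S}_{-1}|:=0$. $a_{\min}:=2\gamma_1\kappa_{\mathrm{mdc}}(1-\eta_2)\min\left\{1,\frac{\Delta_0}{\|\nabla f(x_0)\|^{1-\alpha}}\right\}$. For $x\ge0$, $\psi_\beta(x):=L+x$ if $\beta\in[0,1/L]$ and $\psi_\beta(x):=L(1+x)$ if $\beta\in(1/L,1]$. The $O(\cdot)$ notation refers to $\epsilon\to0$. *)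

theory Defs
  imports "HOL-Analysis.Analysis" "HOL-Library.Landau_Symbols"
begin

(* Real power with the convention 0^0 = 1; the library has 0 powr 0 = 0. *)
definition rpow :: "real \<Rightarrow> real \<Rightarrow> real" where
  "rpow x a = (if x = 0 \<and> a = 0 then 1 else x powr a)"

(* The library norm on real^'n^'n is the Frobenius norm, not the induced one. *)
definition mnorm :: "real^'n^'n \<Rightarrow> real" where
  "mnorm A = onorm ((*v) A)"

definition model ::
  "(real^'n \<Rightarrow> real) \<Rightarrow> (real^'n \<Rightarrow> real^'n) \<Rightarrow> real^'n \<Rightarrow> real^'n^'n \<Rightarrow> real^'n \<Rightarrow> real" where
  "model f g x B s = f x + g x \<bullet> s + 1 / 2 * (s \<bullet> (B *v s))"

definition radius ::
  "(real^'n \<Rightarrow> real^'n) \<Rightarrow> real \<Rightarrow> real \<Rightarrow> real^'n \<Rightarrow> real^'n^'n \<Rightarrow> real \<Rightarrow> real" where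
  "radius g \<alpha> \<beta> x B \<Delta> = rpow (norm (g x)) \<alpha> / rpow (1 + mnorm B) \<beta> * \<Delta>"

definition is_cauchy_stepsize ::
  "(real^'n \<Rightarrow> real) \<Rightarrow> (real^'n \<Rightarrow> real^'n) \<Rightarrow> real^'n \<Rightarrow> real^'n^'n \<Rightarrow> real \<Rightarrow> real \<Rightarrow> bool" where
  "is_cauchy_stepsize f g x B r t \<longleftrightarrow>
     is_arg_min (\<lambda>t. model f g x B (- (t *\<^sub>R g x))) (\<lambda>t. 0 \<le> t \<and> norm (t *\<^sub>R g x) \<le> r) t"

(* If the denominator vanishes the value is 0, so the iteration counts as unsuccessful.
   In a run of the algorithm the denominator can vanish only at a stationary point. *)
definition ratio ::
  "(real^'n \<Rightarrow> real) \<Rightarrow> (real^'n \<Rightarrow> real^'n) \<Rightarrow> real^'n \<Rightarrow> real^'n^'n \<Rightarrow> real^'n \<Rightarrow> real" where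
  "ratio f g x B s = (f x - f (x + s)) / (model f g x B 0 - model f g x B s)"

locale trust_region_run =
  fixes f :: "real^'n \<Rightarrow> real" and g :: "real^'n \<Rightarrow> real^'n"
    and \<eta>1 \<eta>2 \<gamma>1 \<gamma>2 \<gamma>3 \<gamma>4 \<kappa>mdc \<alpha> \<beta> :: real
    and x :: "nat \<Rightarrow> real^'n" and \<Delta> :: "nat \<Rightarrow> real"
    and B :: "nat \<Rightarrow> real^'n^'n" and t :: "nat \<Rightarrow> real" and s :: "nat \<Rightarrow> real^'n"
  assumes \<eta>: "0 < \<eta>1" "\<eta>1 \<le> \<eta>2" "\<eta>2 < 1"
    and \<gamma>: "0 < \<gamma>1" "\<gamma>1 \<le> \<gamma>2" "\<gamma>2 < 1" "1 \<le> \<gamma>3" "\<gamma>3 \<le> \<gamma>4"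
    and \<kappa>mdc: "0 < \<kappa>mdc" "\<kappa>mdc \<le> 1 / 2"
    and \<alpha>: "-1 \<le> \<alpha>" "\<alpha> \<le> 1"
    and \<beta>: "0 \<le> \<beta>" "\<beta> \<le> 1"
    and \<Delta>_init: "0 < \<Delta> 0"
    and B_symmetric: "\<And>k. transpose (B k) = B k"
    and cauchy: "\<And>k. is_cauchy_stepsize f g (x k) (B k) (radius g \<alpha> \<beta> (x k) (B k) (\<Delta> k)) (t k)"
    and step_norm: "\<And>k. norm (s k) \<le> radius g \<alpha> \<beta> (x k) (B k) (\<Delta> k)"
    and step_decrease: "\<And>k. model f g (x k) (B k) 0 - model f g (x k) (B k) (s k)
      \<ge> 2 * \<kappa>mdc * (model f g (x k) (B k) 0 - model f g (x k) (B k) (- (t k *\<^sub>R g (x k))))"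
    and x_update: "\<And>k. x (Suc k) =
      (if ratio f g (x k) (B k) (s k) \<ge> \<eta>1 then x k + s k else x k)"
    and \<Delta>_very_successful: "\<And>k. ratio f g (x k) (B k) (s k) \<ge> \<eta>2 \<Longrightarrow>
      \<Delta> (Suc k) \<in> {\<gamma>3 * \<Delta> k..\<gamma>4 * \<Delta> k}"
    and \<Delta>_successful: "\<And>k. \<eta>1 \<le> ratio f g (x k) (B k) (s k) \<Longrightarrow> ratio f g (x k) (B k) (s k) < \<eta>2 \<Longrightarrow>
      \<Delta> (Suc k) \<in> {\<gamma>2 * \<Delta> k..\<Delta> k}"
    and \<Delta>_unsuccessful: "\<And>k. ratio f g (x k) (B k) (s k) < \<eta>1 \<Longrightarrow>
      \<Delta> (Suc k) \<in> {\<gamma>1 * \<Delta> k..\<gamma>2 * \<Delta> k}"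

(* g0 is the norm of the initial gradient. *)
definition a_min :: "real \<Rightarrow> real \<Rightarrow> real \<Rightarrow> real \<Rightarrow> real \<Rightarrow> real \<Rightarrow> real" where
  "a_min \<gamma>1 \<kappa>mdc \<eta>2 \<alpha> g0 \<Delta>0 =
     2 * \<gamma>1 * \<kappa>mdc * (1 - \<eta>2) * min 1 (\<Delta>0 / rpow g0 (1 - \<alpha>))"

definition psi :: "real \<Rightarrow> real \<Rightarrow> real \<Rightarrow> real" where
  "psi L \<beta> x = (if \<beta> \<le> 1 / L then L + x else L * (1 + x))"

definition crosses :: "(nat \<Rightarrow> real) \<Rightarrow> real \<Rightarrow> nat \<Rightarrow> bool" where
  "crosses \<delta> \<epsilon> k \<longleftrightarrow> \<delta> k > \<epsilon> \<and> \<delta> (Suc k) \<le> \<epsilon>"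

definition khat :: "(nat \<Rightarrow> real) \<Rightarrow> real \<Rightarrow> nat" where
  "khat \<delta> \<epsilon> = (LEAST k. crosses \<delta> \<epsilon> k)"

end

theory Submission
  imports Defs
begin

text \<open>
  Every successful iteration multiplies the optimality gap \<open>\<delta> k = f (x k) - f_low\<close> by a factor that is
  at most \<open>1 - c / \<psi> (M k)\<close>. Here \<open>c\<close> is a constant of the method and \<open>M k\<close> is any bound on the
  Hessian norms seen so far. Unsuccessful iterations leave the gap unchanged. The growth hypothesis
  gives \<open>M k = \<mu> (1 + j\<^sup>p)\<close>, where \<open>j\<close> counts the earlier successes, so taking logarithms turns
  \<open>\<delta> k > \<epsilon>\<close> into an upper bound on \<open>\<Sum>j<N. 1 / \<psi> (\<mu> (1 + j\<^sup>p))\<close>, where \<open>N\<close> is the number of successes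
  before \<open>k\<close> (\<open>sum_le_ln_gap\<close>). As \<open>\<psi>\<close> is affine, the summand with \<open>j \<ge> 1\<close> is at least a constant
  times \<open>j\<^sup>-\<^sup>p\<close>. The sum therefore grows at least like \<open>N\<close>, like \<open>N\<^sup>1\<^sup>-\<^sup>p / (1 - p)\<close> or like \<open>ln N\<close>, and solving for
  \<open>N\<close> gives the three bounds (\<open>weight_sum_const\<close>, \<open>count_le_powr\<close>, \<open>count_le_exp\<close>). In each case
  \<open>N\<close> stays bounded as long as the gap exceeds \<open>\<epsilon>\<close>, so infinitely many successes force the gap
  below every positive \<open>\<epsilon>\<close>.

  The contraction factor rests on three facts.

  \<^item> The Cauchy point decreases the model by at least \<open>\<parallel>g\<parallel>/2\<close> times the smaller of the radius and
    \<open>\<parallel>g\<parallel> / (L + \<parallel>B\<parallel>)\<close> (\<open>cauchy_model_decrease\<close>).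
  \<^item> The radius cannot become too small (\<open>trust_factor_lower_bound\<close>). The model error is quadratic in
    the radius and the predicted decrease is linear in it, so a poor ratio, which is needed for the
    factor \<open>\<Delta>\<close> to shrink, can occur only when the radius is at least a multiple of \<open>\<parallel>g\<parallel> / (L + \<parallel>B\<parallel>)\<close>.
    The bound involves the smallest gradient norm met so far.
  \<^item> Strong convexity gives \<open>2 \<mu>\<^sub>c \<delta> j \<le> \<parallel>g (x j)\<parallel>\<^sup>2\<close> (\<open>gap_le_gradient\<close>). Since the gap never
    increases, \<open>sqrt (2 \<mu>\<^sub>c \<delta> k)\<close> is a lower bound for all gradient norms up to iteration \<open>k\<close>. This
    turns the decrease into a multiple of the gap itself, although the gradient norms need not be
    monotone.
\<close>

section \<open>Concavity of real powers\<close>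

lemma rpow_pos: "0 < a \<Longrightarrow> rpow a e = a powr e"
  by (simp add: rpow_def)

lemma powr_le_tangent:
  fixes a \<theta> :: real
  assumes "0 < a" "0 \<le> \<theta>" "\<theta> \<le> 1"
  shows "a powr \<theta> \<le> 1 + \<theta> * (a - 1)"
  using Youngs_inequality_0[of \<theta> "1 - \<theta>" a 1] assms by (simp add: algebra_simps)

text \<open>
  The discrete form of comparing \<open>\<Sum>j. j\<^sup>-\<^sup>p\<close> with an integral: the concave power lies below its
  tangent at \<open>j\<close>.
\<close>

lemma powr_one_minus_increment_le:
  fixes j p :: real
  assumes "1 \<le> j" "0 < p" "p < 1"
  shows "(j + 1) powr (1 - p) - j powr (1 - p) \<le> (1 - p) * (1 / j powr p)"
proof -
  have "((j + 1) / j) powr (1 - p) \<le> 1 + (1 - p) * ((j + 1) / j - 1)"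
    using assms by (intro powr_le_tangent) auto
  also have "\<dots> = 1 + (1 - p) / j"
    using assms by (simp add: field_simps)
  finally have "((j + 1) / j) powr (1 - p) * j powr (1 - p) \<le> (1 + (1 - p) / j) * j powr (1 - p)"
    by (intro mult_right_mono) auto
  moreover have "((j + 1) / j) powr (1 - p) * j powr (1 - p) = (j + 1) powr (1 - p)"
    using assms by (simp flip: powr_mult)
  moreover have "j powr (1 - p) = j / j powr p"
    using assms by (simp add: powr_diff)
  then have "(1 - p) / j * j powr (1 - p) = (1 - p) * (1 / j powr p)"
    using assms by simp
  ultimately show ?thesis
    by (simp add: distrib_right)
qed

section \<open>Monotonicity and scaling of \<psi>\<close>

lemma psi_ge:
  assumes "1 \<le> L" "0 \<le> b"
  shows "L + b \<le> psi L \<beta> b"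
  using assms mult_right_mono[of 1 L b] by (simp add: psi_def distrib_left)

lemma psi_pos: "1 \<le> L \<Longrightarrow> 0 \<le> b \<Longrightarrow> 0 < psi L \<beta> b"
  using psi_ge[of L b \<beta>] by linarith

lemma psi_mono: "1 \<le> L \<Longrightarrow> a \<le> b \<Longrightarrow> psi L \<beta> a \<le> psi L \<beta> b"
  by (simp add: psi_def)

lemma psi_scale_le:
  assumes "1 \<le> L" "1 \<le> c"
  shows "psi L \<beta> (c * b) \<le> c * psi L \<beta> b"
  using assms mult_right_mono[of 1 c L] by (simp add: psi_def algebra_simps)

text \<open>
  The two branches of \<open>psi\<close> exist for this monotonicity. The quotient \<open>(1 + b)\<^sup>\<beta> / (L + b)\<close> is
  decreasing on \<open>b \<ge> 0\<close> when \<open>\<beta> \<le> 1/L\<close> but may increase near \<open>0\<close> otherwise. Replacing \<open>L + b\<close> by the larger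
  \<open>L (1 + b)\<close> leaves \<open>(1 + b)\<^sup>\<beta>\<^sup>-\<^sup>1 / L\<close>, which always decreases. Thus a bound stated with
  the largest Hessian norm covers all earlier iterations.
\<close>

lemma powr_div_psi_antimono:
  assumes "1 \<le> L" "0 \<le> \<beta>" "\<beta> \<le> 1" "0 \<le> b" "b \<le> M"
  shows "(1 + M) powr \<beta> / psi L \<beta> M \<le> (1 + b) powr \<beta> / psi L \<beta> b"
proof (cases "\<beta> \<le> 1 / L")
  case True
  have "((1 + M) / (1 + b)) powr \<beta> \<le> 1 + \<beta> * ((1 + M) / (1 + b) - 1)"
    using assms by (intro powr_le_tangent) auto
  also have "\<dots> = 1 + \<beta> * ((M - b) / (1 + b))"
    using assms by (simp add: field_simps)
  also have "\<dots> \<le> 1 + 1 / L * ((M - b) / (1 + b))"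
    using assms True by (intro add_left_mono mult_right_mono) auto
  also have "\<dots> = 1 + (M - b) / (L + L * b)"
    by (simp add: distrib_left)
  also have "\<dots> \<le> 1 + (M - b) / (L + b)"
    using assms mult_right_mono[of 1 L b] by (intro add_left_mono divide_left_mono) auto
  also have "\<dots> = (L + M) / (L + b)"
    using assms by (simp add: field_simps)
  finally have "(1 + M) powr \<beta> / (1 + b) powr \<beta> \<le> (L + M) / (L + b)"
    using assms by (simp add: powr_divide)
  then show ?thesis
    using assms True by (simp add: psi_def field_simps)
next
  case False
  have eq: "(1 + c) powr \<beta> / psi L \<beta> c = (1 + c) powr (\<beta> - 1) / L" if "0 \<le> c" for c
    using False that by (simp add: psi_def powr_diff)
  have "(1 + M) powr (\<beta> - 1) \<le> (1 + b) powr (\<beta> - 1)"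
    using assms by (intro powr_mono2') auto
  then show ?thesis
    using assms by (simp add: eq divide_right_mono)
qed

lemma powr_div_psi_le_one:
  assumes "1 \<le> L" "0 \<le> \<beta>" "\<beta> \<le> 1" "0 \<le> b"
  shows "(1 + b) powr \<beta> / psi L \<beta> b \<le> 1"
proof -
  have "(1 + b) powr \<beta> \<le> (1 + b) powr 1"
    using assms by (intro powr_mono) auto
  also have "\<dots> \<le> psi L \<beta> b"
    using assms psi_ge[of L b \<beta>] by simp
  finally show ?thesis
    using assms psi_pos[of L b \<beta>] by simp
qed

section \<open>Sums of reciprocal weights\<close>

text \<open>
  Each successful iteration contributes the reciprocal of \<open>\<psi>\<close> at its Hessian bound. The factor
  \<open>\<psi> (2\<mu>)\<close> normalises the sum so that every summand is \<open>1\<close> when \<open>p = 0\<close>; for \<open>p > 0\<close> the summand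
  with \<open>j = 0\<close> is then the constant \<open>\<kappa>2\<close>.
\<close>

definition weight_sum :: "real \<Rightarrow> real \<Rightarrow> real \<Rightarrow> real \<Rightarrow> nat \<Rightarrow> real" where
  "weight_sum L \<beta> \<mu> p N = (\<Sum>j<N. psi L \<beta> (2 * \<mu>) / psi L \<beta> (\<mu> * (1 + rpow (real j) p)))"

lemma weight_sum_const:
  assumes "1 \<le> L" "0 < \<mu>"
  shows "weight_sum L \<beta> \<mu> 0 N = real N"
proof -
  have "rpow a 0 = 1" for a
    by (simp add: rpow_def)
  then show ?thesis
    using assms psi_pos[of L "2 * \<mu>" \<beta>] by (simp add: weight_sum_def mult.commute)
qed

text \<open>
  For \<open>j \<ge> 1\<close> the argument \<open>\<mu> (1 + j\<^sup>p)\<close> is at most \<open>j\<^sup>p\<close> times \<open>2\<mu>\<close>, and \<open>\<psi>\<close> is affine with nonnegative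
  constant term, so the factor \<open>j\<^sup>p \<ge> 1\<close> can be pulled out of it.
\<close>

lemma weight_ge:
  assumes "1 \<le> L" "0 < \<mu>" "0 \<le> p" "1 \<le> j"
  shows "1 / real j powr p \<le> psi L \<beta> (2 * \<mu>) / psi L \<beta> (\<mu> * (1 + rpow (real j) p))"
proof -
  define c where "c = real j powr p"
  have c: "1 \<le> c"
    using assms by (simp add: c_def ge_one_powr_ge_zero)
  have "psi L \<beta> (\<mu> * (1 + rpow (real j) p)) \<le> psi L \<beta> (c * (2 * \<mu>))"
    using assms c mult_right_mono[of 1 c \<mu>]
    by (intro psi_mono) (auto simp: rpow_pos c_def algebra_simps)
  also have "\<dots> \<le> c * psi L \<beta> (2 * \<mu>)"
    using assms c by (intro psi_scale_le)
  finally have *: "psi L \<beta> (\<mu> * (1 + rpow (real j) p)) \<le> c * psi L \<beta> (2 * \<mu>)" .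
  have "0 < psi L \<beta> (\<mu> * (1 + rpow (real j) p))"
    using assms c by (intro psi_pos) (auto simp: rpow_pos)
  then show ?thesis
    using * c unfolding c_def[symmetric] by (simp add: field_simps)
qed

lemma weight_sum_1:
  assumes "0 < p"
  shows "weight_sum L \<beta> \<mu> p 1 = psi L \<beta> (2 * \<mu>) / psi L \<beta> \<mu>"
  using assms by (simp add: weight_sum_def rpow_def)

lemma weight_sum_ge_powr:
  assumes "1 \<le> L" "0 < \<mu>" "0 < p" "p < 1" "1 \<le> N"
  shows "psi L \<beta> (2 * \<mu>) / psi L \<beta> \<mu> + (real N powr (1 - p) - 1) / (1 - p)
    \<le> weight_sum L \<beta> \<mu> p N"
  using \<open>1 \<le> N\<close>
proof (induction N rule: nat_induct_at_least)
  case base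
  show ?case
    using assms by (simp add: weight_sum_1[simplified])
next
  case (Suc N)
  have "(real (Suc N) powr (1 - p) - real N powr (1 - p)) / (1 - p) \<le> 1 / real N powr p"
    using powr_one_minus_increment_le[of "real N" p] assms Suc.hyps
    by (simp add: field_simps add.commute)
  also have "\<dots> \<le> psi L \<beta> (2 * \<mu>) / psi L \<beta> (\<mu> * (1 + rpow (real N) p))"
    using assms Suc.hyps by (intro weight_ge) auto
  finally show ?case
    using Suc.IH by (simp add: weight_sum_def diff_divide_distrib)
qed

lemma weight_sum_ge_ln:
  assumes "1 \<le> L" "0 < \<mu>" "1 \<le> N"
  shows "psi L \<beta> (2 * \<mu>) / psi L \<beta> \<mu> + ln (real N) \<le> weight_sum L \<beta> \<mu> 1 N"
  using \<open>1 \<le> N\<close>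
proof (induction N rule: nat_induct_at_least)
  case base
  show ?case
    by (simp add: weight_sum_1[simplified])
next
  case (Suc N)
  have "ln (real (Suc N)) - ln (real N) = ln (1 + 1 / real N)"
    using Suc.hyps ln_div[of "real (Suc N)" "real N"] by (simp add: add_divide_distrib add.commute)
  also have "\<dots> \<le> 1 / real N powr 1"
    using Suc.hyps by (simp add: ln_add_one_self_le_self)
  also have "\<dots> \<le> psi L \<beta> (2 * \<mu>) / psi L \<beta> (\<mu> * (1 + rpow (real N) 1))"
    using assms Suc.hyps by (intro weight_ge) auto
  finally show ?case
    using Suc.IH by (simp add: weight_sum_def)
qed

lemma count_le_powr:
  assumes "1 \<le> L" "0 < \<mu>" "0 < p" "p < 1" "weight_sum L \<beta> \<mu> p N \<le> W"
  shows "real N \<le> ((1 - p) * (W - psi L \<beta> (2 * \<mu>) / psi L \<beta> \<mu>) + 1) powr (1 / (1 - p))"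
proof (cases "N = 0")
  case False
  have "(real N powr (1 - p) - 1) / (1 - p) \<le> W - psi L \<beta> (2 * \<mu>) / psi L \<beta> \<mu>"
    using weight_sum_ge_powr[of L \<mu> p N \<beta>] assms False by simp
  then have "real N powr (1 - p) \<le> (1 - p) * (W - psi L \<beta> (2 * \<mu>) / psi L \<beta> \<mu>) + 1"
    using assms by (simp add: field_simps)
  then have "(real N powr (1 - p)) powr (1 / (1 - p))
      \<le> ((1 - p) * (W - psi L \<beta> (2 * \<mu>) / psi L \<beta> \<mu>) + 1) powr (1 / (1 - p))"
    using assms by (intro powr_mono2) auto
  then show ?thesis
    using assms False by (simp add: powr_powr)
qed simp

lemma count_le_exp:
  assumes "1 \<le> L" "0 < \<mu>" "weight_sum L \<beta> \<mu> 1 N \<le> W"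
  shows "real N \<le> exp (W - psi L \<beta> (2 * \<mu>) / psi L \<beta> \<mu>)"
proof (cases "N = 0")
  case False
  then have "ln (real N) \<le> W - psi L \<beta> (2 * \<mu>) / psi L \<beta> \<mu>"
    using weight_sum_ge_ln[of L \<mu> N \<beta>] assms by simp
  then show ?thesis
    using False by (metis exp_le_cancel_iff exp_ln of_nat_0_less_iff neq0_conv)
qed simp

section \<open>Asymptotics as the tolerance tends to zero\<close>

lemma ln_inverse_at_top: "filterlim (\<lambda>\<epsilon>::real. ln (inverse \<epsilon>)) at_top (at_right 0)"
  using filterlim_compose[OF ln_at_top filterlim_inverse_at_top_right] .

lemma eventually_ln_divide:
  fixes d :: real
  assumes "0 < d"
  shows "eventually (\<lambda>\<epsilon>. ln (d / \<epsilon>) = ln d + ln (inverse \<epsilon>)) (at_right 0)"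
  using eventually_at_right_less[of 0]
  by eventually_elim (use assms in \<open>simp add: ln_div ln_inverse\<close>)

lemma affine_ln_bigo:
  fixes d :: real
  assumes "0 < d"
  shows "(\<lambda>\<epsilon>. a * ln (d / \<epsilon>) + b) \<in> O[at_right 0](\<lambda>\<epsilon>. ln (inverse \<epsilon>))"
proof -
  have ge_1: "eventually (\<lambda>\<epsilon>::real. 1 \<le> ln (inverse \<epsilon>)) (at_right 0)"
    using ln_inverse_at_top unfolding filterlim_at_top by blast
  have "eventually (\<lambda>\<epsilon>. norm (a * ln (d / \<epsilon>) + b)
      \<le> (\<bar>a\<bar> + \<bar>a * ln d + b\<bar>) * norm (ln (inverse \<epsilon>))) (at_right 0)"
    using ge_1 eventually_ln_divide[OF assms]
  proof eventually_elim
    case (elim \<epsilon>)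
    define l where "l = ln (inverse \<epsilon>)"
    have l: "1 \<le> l" "\<bar>l\<bar> = l"
      using elim(1) by (auto simp: l_def)
    have "a * ln (d / \<epsilon>) + b = a * l + (a * ln d + b)"
      unfolding elim(2) l_def by (simp add: algebra_simps)
    also have "\<bar>\<dots>\<bar> \<le> \<bar>a\<bar> * l + \<bar>a * ln d + b\<bar> * 1"
      using abs_triangle_ineq[of "a * l" "a * ln d + b"] l by (simp add: abs_mult)
    also have "\<dots> \<le> \<bar>a\<bar> * l + \<bar>a * ln d + b\<bar> * l"
      using l(1) by (intro add_left_mono mult_left_mono) auto
    also have "\<dots> = (\<bar>a\<bar> + \<bar>a * ln d + b\<bar>) * \<bar>l\<bar>"
      by (simp add: l(2) distrib_right)
    finally show ?case
      by (simp only: real_norm_def l_def)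
  qed
  then show ?thesis
    by (rule bigoI)
qed

text \<open>
  The sign of \<open>a\<close> and \<open>q\<close> matters: it makes the base of the power eventually nonnegative, where
  \<open>powr\<close> is monotone.
\<close>

lemma affine_ln_powr_bigo:
  fixes d :: real
  assumes "0 < d" "0 < a" "0 < q"
  shows "(\<lambda>\<epsilon>. (q * (a * ln (d / \<epsilon>) - b) + 1) powr (1 / q))
    \<in> O[at_right 0](\<lambda>\<epsilon>. (q * ln (inverse \<epsilon>)) powr (1 / q))"
proof (rule bigo_powr_nonneg)
  have "(\<lambda>\<epsilon>. (q * a) * ln (d / \<epsilon>) + (1 - q * b)) \<in> O[at_right 0](\<lambda>\<epsilon>. ln (inverse \<epsilon>))"
    by (rule affine_ln_bigo[OF assms(1)])
  moreover have "(\<lambda>\<epsilon>. (q * a) * ln (d / \<epsilon>) + (1 - q * b)) = (\<lambda>\<epsilon>. q * (a * ln (d / \<epsilon>) - b) + 1)"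
    by (rule ext) (simp add: algebra_simps)
  ultimately show "(\<lambda>\<epsilon>. q * (a * ln (d / \<epsilon>) - b) + 1) \<in> O[at_right 0](\<lambda>\<epsilon>. q * ln (inverse \<epsilon>))"
    using assms(3) by (simp only: landau_o.big.cmult)
  show "0 \<le> 1 / q"
    using assms by simp
  show "eventually (\<lambda>\<epsilon>. 0 \<le> q * (a * ln (d / \<epsilon>) - b) + 1) (at_right 0)"
    using filterlim_at_top[THEN iffD1, OF ln_inverse_at_top, rule_format, of "b / a - ln d"]
      eventually_ln_divide[OF assms(1)]
  proof eventually_elim
    case (elim \<epsilon>)
    then have "b / a \<le> ln (d / \<epsilon>)"
      by simp
    then have "0 \<le> a * ln (d / \<epsilon>) - b"
      using assms by (simp add: field_simps)
    then show ?case
      using assms by simp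
  qed
  show "eventually (\<lambda>\<epsilon>. 0 \<le> q * ln (inverse \<epsilon>)) (at_right 0)"
    using filterlim_at_top[THEN iffD1, OF ln_inverse_at_top, rule_format, of 0]
    by eventually_elim (use assms in simp)
qed

lemma exp_ln_bigo:
  fixes d :: real
  assumes "0 < d"
  shows "(\<lambda>\<epsilon>. exp (a * ln (d / \<epsilon>) - b)) \<in> O[at_right 0](\<lambda>\<epsilon>. \<epsilon> powr (- a))"
proof (rule bigoI[of _ "exp (a * ln d - b)"])
  show "eventually (\<lambda>\<epsilon>. norm (exp (a * ln (d / \<epsilon>) - b))
      \<le> exp (a * ln d - b) * norm (\<epsilon> powr (- a))) (at_right 0)"
    using eventually_ln_divide[OF assms] eventually_at_right_less[of 0]
  proof eventually_elim
    case (elim \<epsilon>)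
    have "a * ln (d / \<epsilon>) - b = (a * ln d - b) + (- a) * ln \<epsilon>"
      unfolding elim(1) by (simp add: ln_inverse algebra_simps)
    then have "exp (a * ln (d / \<epsilon>) - b) = exp (a * ln d - b) * exp ((- a) * ln \<epsilon>)"
      by (simp only: exp_add)
    then show ?case
      using elim by (simp add: powr_def)
  qed
qed

section \<open>One iteration of the method\<close>

lemma mnorm_nonneg: "0 \<le> mnorm A"
  unfolding mnorm_def by (intro onorm_pos_le matrix_vector_mul_bounded_linear)

lemma quadratic_form_le_mnorm:
  fixes A :: "real^'n^'n"
  shows "v \<bullet> (A *v v) \<le> mnorm A * (norm v)\<^sup>2"
proof -
  have "v \<bullet> (A *v v) \<le> norm v * norm (A *v v)"
    by (rule norm_cauchy_schwarz)
  also have "\<dots> \<le> norm v * (mnorm A * norm v)"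
    unfolding mnorm_def
    by (intro mult_left_mono onorm matrix_vector_mul_bounded_linear) auto
  finally show ?thesis
    by (simp add: power2_eq_square mult_ac)
qed

lemma model_0: "model f g y A 0 = f y"
  by (simp add: model_def)

text \<open>
  The Cauchy step is at least as good as the trial step of length \<open>min r (\<parallel>g\<parallel> / c)\<close> along the negative
  gradient, on which the quadratic term costs at most half of the linear gain. Any
  positive upper bound \<open>c\<close> of the norm serves, which avoids dividing by a vanishing \<open>\<parallel>B\<parallel>\<close>.
\<close>

lemma cauchy_model_decrease:
  fixes g :: "real^'n \<Rightarrow> real^'n"
  assumes cp: "is_cauchy_stepsize f g y A r \<tau>" and r: "0 \<le> r"
    and c: "mnorm A \<le> c" "0 < c"
  shows "1 / 2 * norm (g y) * min r (norm (g y) / c)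
    \<le> model f g y A 0 - model f g y A (- (\<tau> *\<^sub>R g y))"
proof (cases "g y = 0")
  case True
  then show ?thesis
    by simp
next
  case False
  define \<nu> where "\<nu> = norm (g y)"
  have \<nu>: "0 < \<nu>"
    using False by (simp add: \<nu>_def)
  define \<sigma> where "\<sigma> = min (r / \<nu>) (1 / c)"
  have \<sigma>: "0 \<le> \<sigma>" "\<sigma> * c \<le> 1" "\<sigma> * \<nu> \<le> r"
    using \<nu> c r by (auto simp: \<sigma>_def min_def field_simps)
  \<comment> \<open>\<open>\<sigma>\<close> is feasible, so it cannot beat the minimiser \<open>\<tau>\<close>.\<close>
  have "\<not> model f g y A (- (\<sigma> *\<^sub>R g y)) < model f g y A (- (\<tau> *\<^sub>R g y))"
    using cp \<sigma> unfolding is_cauchy_stepsize_def is_arg_min_def by (auto simp: \<nu>_def)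
  moreover have "model f g y A (- (\<sigma> *\<^sub>R g y))
      = f y - \<sigma> * \<nu>\<^sup>2 + 1 / 2 * \<sigma>\<^sup>2 * (g y \<bullet> (A *v g y))"
  proof -
    have "A *v (- (\<sigma> *\<^sub>R g y)) = - (\<sigma> *\<^sub>R (A *v g y))"
      using linear_scale[OF matrix_vector_mul_linear[of A], of "- \<sigma>" "g y"] by simp
    then show ?thesis
      by (simp add: model_def \<nu>_def power2_eq_square flip: power2_norm_eq_inner)
  qed
  moreover have "1 / 2 * \<sigma>\<^sup>2 * (g y \<bullet> (A *v g y)) \<le> 1 / 2 * \<sigma> * \<nu>\<^sup>2"
  proof -
    have "g y \<bullet> (A *v g y) \<le> c * \<nu>\<^sup>2"
      using quadratic_form_le_mnorm[of "g y" A] mult_right_mono[OF c(1), of "\<nu>\<^sup>2"]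
      by (simp add: \<nu>_def)
    then have "1 / 2 * \<sigma>\<^sup>2 * (g y \<bullet> (A *v g y)) \<le> 1 / 2 * \<sigma>\<^sup>2 * (c * \<nu>\<^sup>2)"
      by (intro mult_left_mono) auto
    also have "\<dots> = 1 / 2 * \<sigma> * \<nu>\<^sup>2 * (\<sigma> * c)"
      by (simp add: power2_eq_square)
    also have "\<dots> \<le> 1 / 2 * \<sigma> * \<nu>\<^sup>2 * 1"
      using \<sigma> by (intro mult_left_mono) auto
    finally show ?thesis
      by simp
  qed
  moreover have "1 / 2 * \<nu> * min r (\<nu> / c) = 1 / 2 * \<sigma> * \<nu>\<^sup>2"
  proof -
    have "min r (\<nu> / c) = \<sigma> * \<nu>"
      using \<nu> c by (auto simp: \<sigma>_def min_def field_simps)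
    then show ?thesis
      by (simp add: power2_eq_square)
  qed
  ultimately show ?thesis
    by (simp add: \<nu>_def model_0)
qed

context trust_region_run
begin

abbreviation \<rho> :: "nat \<Rightarrow> real" where
  "\<rho> k \<equiv> ratio f g (x k) (B k) (s k)"

abbreviation r :: "nat \<Rightarrow> real" where
  "r k \<equiv> radius g \<alpha> \<beta> (x k) (B k) (\<Delta> k)"

abbreviation predicted :: "nat \<Rightarrow> real" where
  "predicted k \<equiv> model f g (x k) (B k) 0 - model f g (x k) (B k) (s k)"

abbreviation amin :: real where
  "amin \<equiv> a_min \<gamma>1 \<kappa>mdc \<eta>2 \<alpha> (norm (g (x 0))) (\<Delta> 0)"

lemma radius_nonneg: "0 \<le> r k"
  using step_norm[of k] norm_ge_zero order_trans by blast

lemma predicted_ge: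
  assumes "mnorm (B k) \<le> c" "0 < c"
  shows "\<kappa>mdc * norm (g (x k)) * min (r k) (norm (g (x k)) / c) \<le> predicted k"
proof -
  have "2 * \<kappa>mdc * (1 / 2 * norm (g (x k)) * min (r k) (norm (g (x k)) / c))
      \<le> 2 * \<kappa>mdc * (model f g (x k) (B k) 0 - model f g (x k) (B k) (- (t k *\<^sub>R g (x k))))"
    using cauchy_model_decrease[OF cauchy radius_nonneg assms] \<kappa>mdc
    by (intro mult_left_mono) auto
  then show ?thesis
    using step_decrease[of k] by simp
qed

lemma predicted_nonneg: "0 \<le> predicted k"
proof -
  have "0 \<le> \<kappa>mdc * norm (g (x k)) * min (r k) (norm (g (x k)) / (1 + mnorm (B k)))"
    using \<kappa>mdc radius_nonneg[of k] mnorm_nonneg[of "B k"] by (auto intro!: mult_nonneg_nonneg)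
  then show ?thesis
    using predicted_ge[of k "1 + mnorm (B k)"] mnorm_nonneg[of "B k"] by simp
qed

text \<open>
  With the default value \<open>0\<close> for a quotient with vanishing denominator, a ratio of at least \<open>\<eta>1 > 0\<close>
  rules out a vanishing predicted decrease. Hence passing the ratio test means a genuine decrease
  of \<open>f\<close>.
\<close>

lemma successful_decrease:
  assumes "\<eta>1 \<le> \<rho> k"
  shows "0 < predicted k" "\<eta>1 * predicted k \<le> f (x k) - f (x (Suc k))"
proof -
  have "\<rho> k \<noteq> 0"
    using assms \<eta> by auto
  then have "predicted k \<noteq> 0"
    by (auto simp: ratio_def)
  then show *: "0 < predicted k"
    using predicted_nonneg[of k] by linarith
  show "\<eta>1 * predicted k \<le> f (x k) - f (x (Suc k))"
    using assms * x_update[of k] by (simp add: ratio_def pos_le_divide_eq)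
qed

lemma f_iterates_antimono: "j \<le> k \<Longrightarrow> f (x k) \<le> f (x j)"
proof (rule lift_Suc_antimono_le[of "\<lambda>k. f (x k)"])
  fix n
  show "f (x (Suc n)) \<le> f (x n)"
  proof (cases "\<eta>1 \<le> \<rho> n")
    case True
    then have "0 \<le> \<eta>1 * predicted n"
      using \<eta> successful_decrease(1)[of n] by simp
    then show ?thesis
      using successful_decrease(2)[OF True] by linarith
  qed (use x_update[of n] in simp)
qed

lemma trust_factor_pos: "0 < \<Delta> k"
proof (induction k)
  case (Suc k)
  have "0 < c * \<Delta> k" if "0 < c" for c
    using that Suc by simp
  from this[of \<gamma>1] this[of \<gamma>2] this[of \<gamma>3] show ?case
    using \<gamma> \<Delta>_very_successful[of k] \<Delta>_successful[of k] \<Delta>_unsuccessful[of k]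
    by (cases "\<eta>2 \<le> \<rho> k"; cases "\<eta>1 \<le> \<rho> k") (auto simp: not_le)
qed (rule \<Delta>_init)

lemma trust_factor_step:
  "\<rho> k < \<eta>2 \<Longrightarrow> \<gamma>1 * \<Delta> k \<le> \<Delta> (Suc k)"
  "\<eta>2 \<le> \<rho> k \<Longrightarrow> \<Delta> k \<le> \<Delta> (Suc k)"
proof -
  have le: "1 * \<Delta> k \<le> \<gamma>3 * \<Delta> k" "\<gamma>1 * \<Delta> k \<le> \<gamma>2 * \<Delta> k"
    using \<gamma> less_imp_le[OF trust_factor_pos[of k]] by (intro mult_right_mono; simp)+
  show "\<Delta> k \<le> \<Delta> (Suc k)" if "\<eta>2 \<le> \<rho> k"
    using \<Delta>_very_successful[OF that] le by simp
  show "\<gamma>1 * \<Delta> k \<le> \<Delta> (Suc k)" if "\<rho> k < \<eta>2"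
  proof (cases "\<eta>1 \<le> \<rho> k")
    case True
    then show ?thesis
      using \<Delta>_successful[of k] that le by simp
  qed (use \<Delta>_unsuccessful[of k] in simp)
qed

lemma radius_eq:
  assumes "g (x k) \<noteq> 0"
  shows "r k = norm (g (x k)) powr \<alpha> / (1 + mnorm (B k)) powr \<beta> * \<Delta> k"
  using assms mnorm_nonneg[of "B k"] by (simp add: radius_def rpow_pos)

lemma amin_bounds:
  assumes "g (x 0) \<noteq> 0"
  shows "0 < amin" "amin \<le> 2 * \<gamma>1 * \<kappa>mdc * (1 - \<eta>2)" "amin \<le> 1"
    "amin \<le> \<Delta> 0 / norm (g (x 0)) powr (1 - \<alpha>)"
proof -
  define c where "c = 2 * \<gamma>1 * \<kappa>mdc * (1 - \<eta>2)"
  define q where "q = \<Delta> 0 / norm (g (x 0)) powr (1 - \<alpha>)"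
  have a: "amin = c * min 1 q"
    using assms by (simp add: a_min_def rpow_pos c_def q_def)
  have q: "0 < q"
    using assms \<Delta>_init by (simp add: q_def)
  have c0: "0 < c"
    using \<gamma> \<kappa>mdc \<eta> by (simp add: c_def)
  have "\<gamma>1 * (2 * \<kappa>mdc * (1 - \<eta>2)) \<le> 1 * (1 * 1)"
    using \<gamma> \<kappa>mdc \<eta> by (intro mult_mono) auto
  then have c1: "c \<le> 1"
    by (simp add: c_def mult_ac)
  show "0 < amin"
    using a q c0 by simp
  show "amin \<le> 2 * \<gamma>1 * \<kappa>mdc * (1 - \<eta>2)"
    using mult_left_mono[of "min 1 q" 1 c] a c0 by (simp add: c_def)
  then show "amin \<le> 1"
    using c1 by (simp add: c_def)
  have "c * min 1 q \<le> 1 * q"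
    using c0 c1 q by (intro mult_mono) auto
  then show "amin \<le> \<Delta> 0 / norm (g (x 0)) powr (1 - \<alpha>)"
    using a by (simp add: q_def)
qed

end

section \<open>Lower bounds on the radius and on the decrease\<close>

locale accurate_trust_region_run = trust_region_run +
  fixes L :: real
  assumes L: "1 \<le> L"
    and model_error: "\<And>k. \<bar>f (x k + s k) - model f g (x k) (B k) (s k)\<bar>
           \<le> 1 / 2 * (L + mnorm (B k)) * (norm (s k))\<^sup>2"
begin

text \<open>
  A ratio below \<open>\<eta>2\<close> means that the model error exceeds \<open>1 - \<eta>2\<close> times the predicted decrease. If
  the radius is at most \<open>\<parallel>g\<parallel> / (L + \<parallel>B\<parallel>)\<close>, the error is quadratic in the radius while the prediction
  is linear in it, and dividing by the radius gives the claim. A larger radius satisfies it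
  directly, since \<open>2 \<kappa>mdc (1 - \<eta>2) \<le> 1\<close>.
\<close>

lemma radius_large_of_low_ratio:
  assumes "\<rho> k < \<eta>2" "g (x k) \<noteq> 0"
  shows "2 * \<kappa>mdc * (1 - \<eta>2) * norm (g (x k)) / (L + mnorm (B k)) \<le> r k"
proof -
  define \<nu> where "\<nu> = norm (g (x k))"
  define c where "c = L + mnorm (B k)"
  have c: "0 < c" "mnorm (B k) \<le> c"
    using L mnorm_nonneg[of "B k"] by (auto simp: c_def)
  have \<nu>: "0 < \<nu>"
    using assms by (simp add: \<nu>_def)
  have rpos: "0 < r k"
    using radius_eq[OF assms(2)] trust_factor_pos[of k] assms(2) mnorm_nonneg[of "B k"] by simp
  have pred: "\<kappa>mdc * \<nu> * min (r k) (\<nu> / c) \<le> predicted k"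
    using predicted_ge[OF c(2,1)] by (simp add: \<nu>_def)
  have "0 < \<kappa>mdc * \<nu> * min (r k) (\<nu> / c)"
    using \<kappa>mdc \<nu> c rpos by simp
  then have "0 < predicted k"
    using pred by linarith
  then have "f (x k) - f (x k + s k) < \<eta>2 * predicted k"
    using assms(1) by (simp add: ratio_def pos_divide_less_eq)
  then have "(1 - \<eta>2) * predicted k < f (x k + s k) - model f g (x k) (B k) (s k)"
    by (simp add: model_0 algebra_simps)
  also have "\<dots> \<le> 1 / 2 * c * (norm (s k))\<^sup>2"
    unfolding c_def by (rule order_trans[OF abs_ge_self model_error])
  also have "\<dots> \<le> 1 / 2 * c * (r k)\<^sup>2"
    using c step_norm[of k] by (intro mult_left_mono power_mono) auto
  finally have upper: "(1 - \<eta>2) * predicted k < 1 / 2 * c * (r k)\<^sup>2" .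
  have "2 * \<kappa>mdc * (1 - \<eta>2) * \<nu> / c \<le> r k"
  proof (cases "r k \<le> \<nu> / c")
    case True
    have "(1 - \<eta>2) * (\<kappa>mdc * \<nu> * r k) \<le> (1 - \<eta>2) * predicted k"
      using pred True \<eta> by (intro mult_left_mono) auto
    also note upper
    finally have "(1 - \<eta>2) * \<kappa>mdc * \<nu> * r k < (1 / 2 * c * r k) * r k"
      by (simp add: power2_eq_square mult_ac)
    then have "(1 - \<eta>2) * \<kappa>mdc * \<nu> < 1 / 2 * c * r k"
      using rpos by (simp add: mult_less_cancel_right)
    then show ?thesis
      using c by (simp add: field_simps)
  next
    case False
    have "2 * \<kappa>mdc * (1 - \<eta>2) \<le> 1 * 1"
      using \<kappa>mdc \<eta> by (intro mult_mono) auto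
    then have "2 * \<kappa>mdc * (1 - \<eta>2) * (\<nu> / c) \<le> 1 * (\<nu> / c)"
      using \<nu> c by (intro mult_right_mono) auto
    then show ?thesis
      using False by simp
  qed
  then show ?thesis
    by (simp add: \<nu>_def c_def)
qed

text \<open>
  The preceding bound solved for the factor \<open>\<Delta> k\<close> of the radius, with \<open>L + \<parallel>B\<parallel>\<close> weakened to \<open>\<psi>\<close> so
  that the dependence on \<open>\<parallel>B\<parallel>\<close> becomes monotone.
\<close>

lemma trust_factor_large_of_low_ratio:
  assumes "\<rho> k < \<eta>2" "g (x k) \<noteq> 0"
  shows "2 * \<kappa>mdc * (1 - \<eta>2) * norm (g (x k)) powr (1 - \<alpha>)
      * ((1 + mnorm (B k)) powr \<beta> / psi L \<beta> (mnorm (B k))) \<le> \<Delta> k"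
proof -
  define \<nu> where "\<nu> = norm (g (x k))"
  define b where "b = mnorm (B k)"
  define C where "C = 2 * \<kappa>mdc * (1 - \<eta>2)"
  have \<nu>: "0 < \<nu>" and b: "0 \<le> b" and C: "0 < C"
    using assms mnorm_nonneg[of "B k"] \<kappa>mdc \<eta> by (auto simp: \<nu>_def b_def C_def)
  have "C * \<nu> / psi L \<beta> b \<le> C * \<nu> / (L + b)"
    using C \<nu> b L psi_ge[OF L b, of \<beta>] psi_pos[OF L b, of \<beta>]
    by (intro divide_left_mono) (auto intro!: mult_pos_pos)
  also have "\<dots> \<le> \<nu> powr \<alpha> / (1 + b) powr \<beta> * \<Delta> k"
    using radius_large_of_low_ratio[OF assms] radius_eq[OF assms(2)]
    by (simp add: C_def \<nu>_def b_def)
  finally have "C * \<nu> / psi L \<beta> b * ((1 + b) powr \<beta> / \<nu> powr \<alpha>)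
      \<le> \<nu> powr \<alpha> / (1 + b) powr \<beta> * \<Delta> k * ((1 + b) powr \<beta> / \<nu> powr \<alpha>)"
    by (intro mult_right_mono) auto
  also have "\<dots> = \<Delta> k"
    using \<nu> b by simp
  also have "C * \<nu> / psi L \<beta> b * ((1 + b) powr \<beta> / \<nu> powr \<alpha>)
      = C * \<nu> powr (1 - \<alpha>) * ((1 + b) powr \<beta> / psi L \<beta> b)"
    using \<nu> by (simp add: powr_diff)
  finally show ?thesis
    by (simp add: C_def \<nu>_def b_def)
qed

text \<open>
  The factor shrinks only after a ratio below \<open>\<eta>2\<close>, and then to at least \<open>\<gamma>1\<close> times a value that
  is already large; the constant \<open>amin\<close> absorbs this one reduction and the initial value. Taking
  arbitrary bounds \<open>G\<close> and \<open>M\<close> valid up to \<open>k\<close>, rather than the running minimum and maximum, lets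
  the induction keep them fixed.
\<close>

lemma trust_factor_lower_bound:
  assumes G: "0 < G" "\<And>j. j \<le> k \<Longrightarrow> G \<le> norm (g (x j))"
    and M: "\<And>j. j \<le> k \<Longrightarrow> mnorm (B j) \<le> M"
  shows "amin * G powr (1 - \<alpha>) * ((1 + M) powr \<beta> / psi L \<beta> M) \<le> \<Delta> k"
  using assms(2,3)
proof (induction k)
  case 0
  have M0: "0 \<le> M"
    using 0(2)[of 0] mnorm_nonneg[of "B 0"] by simp
  have g0: "g (x 0) \<noteq> 0"
    using G(1) 0(1)[of 0] by auto
  have "amin * G powr (1 - \<alpha>) * ((1 + M) powr \<beta> / psi L \<beta> M)
      \<le> (\<Delta> 0 / norm (g (x 0)) powr (1 - \<alpha>)) * norm (g (x 0)) powr (1 - \<alpha>) * 1"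
    using amin_bounds[OF g0] G(1) 0(1)[of 0] \<alpha> \<beta> M0 L \<Delta>_init psi_pos[OF L M0, of \<beta>]
    by (intro mult_mono powr_mono2 powr_div_psi_le_one) auto
  then show ?case
    using g0 by simp
next
  case (Suc k)
  have IH: "amin * G powr (1 - \<alpha>) * ((1 + M) powr \<beta> / psi L \<beta> M) \<le> \<Delta> k"
    using Suc.prems by (intro Suc.IH) auto
  have Gk: "G \<le> norm (g (x k))" "G \<le> norm (g (x 0))" and Mk: "mnorm (B k) \<le> M"
    using Suc.prems by auto
  have M0: "0 \<le> M"
    using Mk mnorm_nonneg[of "B k"] by simp
  have nz: "g (x k) \<noteq> 0" "g (x 0) \<noteq> 0"
    using G(1) Gk by auto
  show ?case
  proof (cases "\<eta>2 \<le> \<rho> k")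
    case True
    then show ?thesis
      using IH trust_factor_step(2)[OF True] by linarith
  next
    case False
    then have low: "\<rho> k < \<eta>2"
      by simp
    define C where "C = 2 * \<kappa>mdc * (1 - \<eta>2)"
    have C: "0 < C"
      using \<kappa>mdc \<eta> by (simp add: C_def)
    have aC: "amin \<le> \<gamma>1 * C"
      using amin_bounds(2)[OF nz(2)] by (simp add: C_def mult_ac)
    have "amin * G powr (1 - \<alpha>) * ((1 + M) powr \<beta> / psi L \<beta> M)
        \<le> (\<gamma>1 * C) * norm (g (x k)) powr (1 - \<alpha>)
          * ((1 + mnorm (B k)) powr \<beta> / psi L \<beta> (mnorm (B k)))"
      using aC G(1) Gk \<alpha> \<beta> M0 L Mk mnorm_nonneg[of "B k"] C \<gamma>(1) psi_pos[OF L M0, of \<beta>]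
      by (intro mult_mono powr_mono2 powr_div_psi_antimono) auto
    also have "\<dots> \<le> \<gamma>1 * \<Delta> k"
      using mult_left_mono[OF trust_factor_large_of_low_ratio[OF low nz(1)], of \<gamma>1] \<gamma>
      by (simp add: C_def mult_ac)
    also have "\<dots> \<le> \<Delta> (Suc k)"
      by (rule trust_factor_step(1)[OF low])
    finally show ?thesis .
  qed
qed

text \<open>
  With the radius bound inserted, the first entry of the minimum in the Cauchy decrease yields
  \<open>\<parallel>g\<parallel>\<^sup>1\<^sup>+\<^sup>\<alpha> G\<^sup>1\<^sup>-\<^sup>\<alpha>\<close>, which is at least \<open>G\<^sup>2\<close> because \<open>\<alpha> \<ge> -1\<close>; this is why \<open>\<alpha>\<close> disappears from the
  rate. The second entry yields \<open>\<parallel>g\<parallel>\<^sup>2\<close> and is handled by \<open>amin \<le> 1\<close>.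
\<close>

lemma successful_decrease_ge:
  assumes succ: "\<eta>1 \<le> \<rho> k"
    and G: "0 < G" "\<And>j. j \<le> k \<Longrightarrow> G \<le> norm (g (x j))"
    and M: "\<And>j. j \<le> k \<Longrightarrow> mnorm (B j) \<le> M"
  shows "\<eta>1 * \<kappa>mdc * amin * G\<^sup>2 / psi L \<beta> M \<le> f (x k) - f (x (Suc k))"
proof -
  define \<nu> where "\<nu> = norm (g (x k))"
  define b where "b = mnorm (B k)"
  define \<Psi> where "\<Psi> = psi L \<beta> M"
  have b: "0 \<le> b" "b \<le> M"
    using M[of k] mnorm_nonneg[of "B k"] by (auto simp: b_def)
  have G\<nu>: "G \<le> \<nu>" "0 < \<nu>"
    using G(1) G(2)[of k] by (auto simp: \<nu>_def)
  have nz: "g (x k) \<noteq> 0" "g (x 0) \<noteq> 0"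
    using G(1) G(2)[of k] G(2)[of 0] by auto
  note a = amin_bounds[OF nz(2)]
  have \<Psi>: "0 < \<Psi>" "L + b \<le> \<Psi>"
    using psi_pos[OF L, of M \<beta>] psi_ge[OF L, of M \<beta>] b by (auto simp: \<Psi>_def)
  have "amin * G\<^sup>2 / \<Psi> \<le> \<nu> * r k"
  proof -
    have "amin * G powr (1 - \<alpha>) / \<Psi> * (1 + b) powr \<beta>
        \<le> amin * G powr (1 - \<alpha>) / \<Psi> * (1 + M) powr \<beta>"
      using a G b \<Psi> \<beta> by (intro mult_left_mono powr_mono2) auto
    also have "\<dots> \<le> \<Delta> k"
      using trust_factor_lower_bound[OF G M] by (simp add: \<Psi>_def)
    finally have "amin * G powr (1 - \<alpha>) / \<Psi> \<le> \<Delta> k / (1 + b) powr \<beta>"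
      using b by (simp add: pos_le_divide_eq)
    then have "\<nu> powr (1 + \<alpha>) * (amin * G powr (1 - \<alpha>) / \<Psi>)
        \<le> \<nu> powr (1 + \<alpha>) * (\<Delta> k / (1 + b) powr \<beta>)"
      by (intro mult_left_mono) auto
    also have "\<dots> = \<nu> * r k"
      using radius_eq[OF nz(1)] G\<nu> by (simp add: \<nu>_def b_def powr_add)
    finally have "\<nu> powr (1 + \<alpha>) * (amin * G powr (1 - \<alpha>) / \<Psi>) \<le> \<nu> * r k" .
    moreover have "G powr (1 + \<alpha>) * (amin * G powr (1 - \<alpha>) / \<Psi>)
        \<le> \<nu> powr (1 + \<alpha>) * (amin * G powr (1 - \<alpha>) / \<Psi>)"
      using a G G\<nu> \<Psi> \<alpha> by (intro mult_right_mono powr_mono2) auto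
    moreover have "G powr (1 + \<alpha>) * (amin * G powr (1 - \<alpha>) / \<Psi>) = amin * G\<^sup>2 / \<Psi>"
    proof -
      have "G powr (1 + \<alpha>) * G powr (1 - \<alpha>) = G\<^sup>2"
        using G(1) by (simp flip: powr_add)
      then show ?thesis
        by (simp add: mult_ac)
    qed
    ultimately show ?thesis
      by linarith
  qed
  moreover have "amin * G\<^sup>2 / \<Psi> \<le> \<nu> * (\<nu> / (L + b))"
  proof -
    have "amin * G\<^sup>2 / \<Psi> \<le> 1 * \<nu>\<^sup>2 / (L + b)"
      using a G G\<nu> \<Psi> L b by (intro frac_le mult_mono power_mono) auto
    then show ?thesis
      by (simp add: power2_eq_square)
  qed
  ultimately have "amin * G\<^sup>2 / \<Psi> \<le> \<nu> * min (r k) (\<nu> / (L + b))"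
    by (simp add: min_def)
  then have "\<kappa>mdc * (amin * G\<^sup>2 / \<Psi>) \<le> \<kappa>mdc * (\<nu> * min (r k) (\<nu> / (L + b)))"
    using \<kappa>mdc by (intro mult_left_mono) auto
  also have "\<dots> \<le> predicted k"
    using predicted_ge[of k "L + b"] L b by (simp add: \<nu>_def b_def mult_ac)
  finally have "\<eta>1 * (\<kappa>mdc * (amin * G\<^sup>2 / \<Psi>)) \<le> \<eta>1 * predicted k"
    using \<eta> by (intro mult_left_mono) auto
  then show ?thesis
    using successful_decrease(2)[OF succ] by (simp add: \<Psi>_def mult_ac)
qed

end

section \<open>Contraction of the optimality gap under strong convexity\<close>

text \<open>
  Minimising the strongly convex lower bound over \<open>z\<close>, that is, completing the square in
  \<open>v + m (z - y)\<close>.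
\<close>

lemma gap_le_gradient_norm_square:
  fixes f :: "'a::real_inner \<Rightarrow> real"
  assumes "0 < m" "f y + v \<bullet> (z - y) + m / 2 * (norm (z - y))\<^sup>2 \<le> f z"
  shows "2 * m * (f y - f z) \<le> (norm v)\<^sup>2"
proof -
  have "0 \<le> (norm (v + m *\<^sub>R (z - y)))\<^sup>2"
    by simp
  also have "\<dots> = (norm v)\<^sup>2 + 2 * m * (v \<bullet> (z - y)) + m\<^sup>2 * (norm (z - y))\<^sup>2"
    unfolding power2_norm_eq_inner by (simp add: algebra_simps inner_commute power2_eq_square)
  finally have "0 \<le> (norm v)\<^sup>2 + 2 * m * (v \<bullet> (z - y) + m / 2 * (norm (z - y))\<^sup>2)"
    by (simp add: algebra_simps power2_eq_square)
  moreover have "2 * m * (v \<bullet> (z - y) + m / 2 * (norm (z - y))\<^sup>2) \<le> 2 * m * (f z - f y)"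
    using assms by (intro mult_left_mono) auto
  ultimately show ?thesis
    by (simp add: algebra_simps)
qed

locale strongly_convex_trust_region_run = accurate_trust_region_run +
  fixes f_low \<mu>\<^sub>c \<mu> p :: real
  assumes f_low: "f_low \<in> range f" "\<And>y. f_low \<le> f y"
    and \<mu>\<^sub>c: "0 < \<mu>\<^sub>c"
    and strongly_convex: "\<And>y z. f z \<ge> f y + g y \<bullet> (z - y) + \<mu>\<^sub>c / 2 * (norm (z - y))\<^sup>2"
    and \<mu>: "0 < \<mu>"
    and B_growth: "\<And>j k. j \<le> k \<Longrightarrow>
      mnorm (B j) \<le> \<mu> * (1 + rpow (real (card {i. \<eta>1 \<le> \<rho> i \<and> i < k})) p)"
begin

abbreviation \<delta> :: "nat \<Rightarrow> real" where
  "\<delta> k \<equiv> f (x k) - f_low"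

abbreviation successes_before :: "nat \<Rightarrow> nat" where
  "successes_before k \<equiv> card {i. \<eta>1 \<le> \<rho> i \<and> i < k}"

abbreviation contraction :: real where
  "contraction \<equiv> 2 * \<mu>\<^sub>c * \<eta>1 * \<kappa>mdc * amin"

lemma gap_nonneg: "0 \<le> \<delta> k"
  using f_low by simp

text \<open>
  A successful step strictly decreases \<open>f\<close>, which is impossible from a minimiser. This excludes
  vanishing gradients up to any successful iteration.
\<close>

lemma gap_pos_of_successful:
  assumes "\<eta>1 \<le> \<rho> k"
  shows "0 < \<delta> k"
proof -
  have "0 < \<eta>1 * predicted k"
    using \<eta> successful_decrease(1)[OF assms] by simp
  then show ?thesis
    using successful_decrease(2)[OF assms] gap_nonneg[of "Suc k"] by linarith
qed

lemma gap_le_gradient: "2 * \<mu>\<^sub>c * \<delta> k \<le> (norm (g (x k)))\<^sup>2"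
proof -
  obtain z where "f z = f_low"
    using f_low(1) by auto
  then show ?thesis
    using gap_le_gradient_norm_square[OF \<mu>\<^sub>c strongly_convex[of "x k" z]] by simp
qed

text \<open>
  The decrease is applied with \<open>G = sqrt (2 \<mu>\<^sub>c \<delta> k)\<close>, which lies below every earlier gradient norm
  because the gap never increases.
\<close>

lemma gap_contraction:
  assumes "\<eta>1 \<le> \<rho> k"
  shows "\<delta> (Suc k) \<le> \<delta> k * (1 - contraction / psi L \<beta> (\<mu> * (1 + rpow (real (successes_before k)) p)))"
proof -
  define G where "G = sqrt (2 * \<mu>\<^sub>c * \<delta> k)"
  have \<delta>: "0 < \<delta> k"
    by (rule gap_pos_of_successful[OF assms])
  have G: "0 < G" "G\<^sup>2 = 2 * \<mu>\<^sub>c * \<delta> k"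
    using \<delta> \<mu>\<^sub>c by (auto simp: G_def)
  have "G \<le> norm (g (x j))" if "j \<le> k" for j
  proof -
    have "2 * \<mu>\<^sub>c * \<delta> k \<le> 2 * \<mu>\<^sub>c * \<delta> j"
      using f_iterates_antimono[OF that] \<mu>\<^sub>c by (intro mult_left_mono) auto
    also have "\<dots> \<le> (norm (g (x j)))\<^sup>2"
      by (rule gap_le_gradient)
    finally show ?thesis
      unfolding G_def by (intro real_le_lsqrt) auto
  qed
  from successful_decrease_ge[OF assms G(1) this B_growth] show ?thesis
    unfolding G(2) by (simp add: algebra_simps)
qed

lemma amin_pos_of_gap_pos:
  assumes "0 < \<delta> k"
  shows "0 < amin"
proof (rule amin_bounds(1))
  have "0 < 2 * \<mu>\<^sub>c * \<delta> 0"
    using assms f_iterates_antimono[of 0 k] \<mu>\<^sub>c by simp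
  then show "g (x 0) \<noteq> 0"
    using gap_le_gradient[of 0] by auto
qed

lemma successes_before_Suc:
  "successes_before (Suc k) = (if \<eta>1 \<le> \<rho> k then Suc (successes_before k) else successes_before k)"
proof -
  have "{i. \<eta>1 \<le> \<rho> i \<and> i < Suc k}
      = (if \<eta>1 \<le> \<rho> k then insert k {i. \<eta>1 \<le> \<rho> i \<and> i < k} else {i. \<eta>1 \<le> \<rho> i \<and> i < k})"
    by (auto simp: less_Suc_eq)
  then show ?thesis
    by simp
qed

text \<open>
  Telescoping \<open>ln (\<delta> k / \<delta> (k + 1))\<close>: by \<open>ln (1 - q) \<le> -q\<close> a success contributes at least its term
  \<open>q\<close>. Consecutive successes use consecutive indices \<open>j\<close>, since the Hessian bound at a success
  depends only on the number of earlier ones.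
\<close>

lemma sum_le_ln_gap:
  assumes "0 < \<delta> k"
  shows "(\<Sum>j<successes_before k. contraction / psi L \<beta> (\<mu> * (1 + rpow (real j) p)))
    \<le> ln (\<delta> 0 / \<delta> k)"
  using assms
proof (induction k)
  case (Suc k)
  have \<delta>k: "0 < \<delta> k"
    using Suc.prems f_iterates_antimono[of k "Suc k"] by simp
  have \<delta>0: "0 < \<delta> 0"
    using \<delta>k f_iterates_antimono[of 0 k] by simp
  show ?case
  proof (cases "\<eta>1 \<le> \<rho> k")
    case True
    define q where "q = contraction / psi L \<beta> (\<mu> * (1 + rpow (real (successes_before k)) p))"
    have step: "\<delta> (Suc k) \<le> \<delta> k * (1 - q)"
      using gap_contraction[OF True] by (simp add: q_def)
    then have "\<delta> (Suc k) / \<delta> k \<le> 1 - q"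
      using \<delta>k by (simp add: pos_divide_le_eq mult.commute)
    then have "ln (\<delta> (Suc k) / \<delta> k) \<le> - q"
      using ln_le_minus_one[of "\<delta> (Suc k) / \<delta> k"] Suc.prems \<delta>k by simp
    then have "q \<le> ln (\<delta> k / \<delta> (Suc k))"
      using Suc.prems \<delta>k by (simp add: ln_div)
    then show ?thesis
      using True Suc.IH[OF \<delta>k] Suc.prems \<delta>k \<delta>0
      by (simp add: successes_before_Suc ln_div q_def)
  next
    case False
    then show ?thesis
      using Suc.IH[OF \<delta>k] x_update[of k] by (simp add: successes_before_Suc)
  qed
qed simp

lemma weight_sum_le_ln:
  assumes "0 < \<epsilon>" "\<epsilon> < \<delta> k"
  shows "weight_sum L \<beta> \<mu> p (successes_before k)
    \<le> psi L \<beta> (2 * \<mu>) / contraction * ln (\<delta> 0 / \<epsilon>)"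
proof -
  have \<delta>k: "0 < \<delta> k"
    using assms by simp
  have \<delta>0: "0 < \<delta> 0"
    using \<delta>k f_iterates_antimono[of 0 k] by simp
  have c: "0 < contraction"
    using amin_pos_of_gap_pos[OF \<delta>k] \<mu>\<^sub>c \<eta> \<kappa>mdc by simp
  have \<Psi>: "0 < psi L \<beta> (2 * \<mu>)"
    using psi_pos[OF L] \<mu> by simp
  have "weight_sum L \<beta> \<mu> p (successes_before k)
      = psi L \<beta> (2 * \<mu>) / contraction
        * (\<Sum>j<successes_before k. contraction / psi L \<beta> (\<mu> * (1 + rpow (real j) p)))"
    using c unfolding weight_sum_def sum_distrib_left by (intro sum.cong) auto
  also have "\<dots> \<le> psi L \<beta> (2 * \<mu>) / contraction * ln (\<delta> 0 / \<delta> k)"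
    using sum_le_ln_gap[OF \<delta>k] c \<Psi> by (intro mult_left_mono) auto
  also have "\<dots> \<le> psi L \<beta> (2 * \<mu>) / contraction * ln (\<delta> 0 / \<epsilon>)"
    using c \<Psi> assms \<delta>0 \<delta>k by (intro mult_left_mono ln_mono divide_left_mono) (auto simp: field_simps)
  finally show ?thesis .
qed

end

lemma crosses_exists:
  assumes "\<epsilon> < d 0" "d n \<le> \<epsilon>"
  shows "\<exists>k. crosses d \<epsilon> k"
proof -
  have "0 < n"
    using assms by (cases n) auto
  have "\<exists>k\<le>n. d k \<le> \<epsilon> \<and> (\<forall>i<k. \<not> d i \<le> \<epsilon>)"
    using ex_least_nat_le[of "\<lambda>n. d n \<le> \<epsilon>"] assms(2) by blast
  then obtain k where k: "d k \<le> \<epsilon>" "\<And>i. i < k \<Longrightarrow> \<not> d i \<le> \<epsilon>"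
    by blast
  then obtain j where "k = Suc j"
    using assms(1) by (cases k) auto
  then show ?thesis
    using k by (auto simp: crosses_def not_le)
qed

lemma infinite_card_below_unbounded:
  fixes S :: "nat set"
  assumes "infinite S"
  shows "\<exists>k. N \<le> card {i \<in> S. i < k}"
proof -
  obtain T where T: "T \<subseteq> S" "finite T" "card T = N"
    using infinite_arbitrarily_large[OF assms] by blast
  then have "T \<subseteq> {i \<in> S. i < Suc (Max T)}"
    by (auto simp: le_imp_less_Suc)
  then show ?thesis
    using card_mono[of "{i \<in> S. i < Suc (Max T)}" T] T by auto
qed

section \<open>Iteration complexity\<close>

theorem theorem7:
  fixes f :: "real^'n \<Rightarrow> real" and g :: "real^'n \<Rightarrow> real^'n"
    and \<eta>1 \<eta>2 \<gamma>1 \<gamma>2 \<gamma>3 \<gamma>4 \<kappa>mdc \<alpha> \<beta> :: real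
    and x :: "nat \<Rightarrow> real^'n" and \<Delta> :: "nat \<Rightarrow> real"
    and B :: "nat \<Rightarrow> real^'n^'n" and t :: "nat \<Rightarrow> real" and s :: "nat \<Rightarrow> real^'n"
    and f_low \<mu>\<^sub>c L \<mu> p \<kappa>0 \<kappa>2 :: real
    and S :: "nat set" and \<delta> :: "nat \<Rightarrow> real" and Shat :: "real \<Rightarrow> nat set"
  assumes grad: "\<And>y. GDERIV f y :> g y"
    and grad_continuous: "continuous_on UNIV g"
    and f_low: "f_low \<in> range f" "\<And>y. f_low \<le> f y"
    and mu_c: "\<mu>\<^sub>c > 0"
    and strongly_convex: "\<And>y z. f z \<ge> f y + g y \<bullet> (z - y) + \<mu>\<^sub>c / 2 * (norm (z - y))\<^sup>2"
    and run: "trust_region_run f g \<eta>1 \<eta>2 \<gamma>1 \<gamma>2 \<gamma>3 \<gamma>4 \<kappa>mdc \<alpha> \<beta> x \<Delta> B t s"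
    and L: "L \<ge> 1"
    and model_error: "\<And>k. \<bar>f (x k + s k) - model f g (x k) (B k) (s k)\<bar>
           \<le> 1 / 2 * (L + mnorm (B k)) * (norm (s k))\<^sup>2"
    and S_eq: "S = {i. ratio f g (x i) (B i) (s i) \<ge> \<eta>1}"
    and mu: "\<mu> > 0" and p: "0 \<le> p" "p \<le> 1"
    and B_growth: "\<And>k. Max ((\<lambda>j. mnorm (B j)) ` {0..k})
           \<le> \<mu> * (1 + rpow (real (card {i \<in> S. i < k})) p)"
    and S_infinite: "infinite S"
    and kappa0: "\<kappa>0 = psi L \<beta> (2 * \<mu>) /
           (\<eta>1 * \<kappa>mdc * a_min \<gamma>1 \<kappa>mdc \<eta>2 \<alpha> (norm (g (x 0))) (\<Delta> 0))"
    and kappa2: "\<kappa>2 = psi L \<beta> (2 * \<mu>) / psi L \<beta> \<mu>"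
    and delta: "\<And>k. \<delta> k = f (x k) - f_low"
    and Shat: "\<And>\<epsilon>. Shat \<epsilon> = {k \<in> S. k < khat \<delta> \<epsilon>}"
  shows "(\<forall>\<epsilon>. 0 < \<epsilon> \<and> \<epsilon> < \<delta> 0 \<longrightarrow> (\<exists>k. crosses \<delta> \<epsilon> k)) \<and>
    (p = 0 \<longrightarrow>
      (\<forall>\<epsilon>>0. (\<exists>k. crosses \<delta> \<epsilon> k) \<longrightarrow>
         real (card (Shat \<epsilon>)) \<le> \<kappa>0 / (2 * \<mu>\<^sub>c) * ln (\<delta> 0 / \<epsilon>)) \<and>
      (\<lambda>\<epsilon>. \<kappa>0 / (2 * \<mu>\<^sub>c) * ln (\<delta> 0 / \<epsilon>)) \<in> O[at_right 0](\<lambda>\<epsilon>. ln (inverse \<epsilon>)) \<and>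
      (\<lambda>\<epsilon>. real (card (Shat \<epsilon>))) \<in> O[at_right 0](\<lambda>\<epsilon>. ln (inverse \<epsilon>))) \<and>
    (0 < p \<and> p < 1 \<longrightarrow>
      (\<forall>\<epsilon>>0. (\<exists>k. crosses \<delta> \<epsilon> k) \<longrightarrow>
         real (card (Shat \<epsilon>))
           \<le> ((1 - p) * (\<kappa>0 / (2 * \<mu>\<^sub>c) * ln (\<delta> 0 / \<epsilon>) - \<kappa>2) + 1) powr (1 / (1 - p))) \<and>
      (\<lambda>\<epsilon>. ((1 - p) * (\<kappa>0 / (2 * \<mu>\<^sub>c) * ln (\<delta> 0 / \<epsilon>) - \<kappa>2) + 1) powr (1 / (1 - p)))
        \<in> O[at_right 0](\<lambda>\<epsilon>. ((1 - p) * ln (inverse \<epsilon>)) powr (1 / (1 - p))) \<and>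
      (\<lambda>\<epsilon>. real (card (Shat \<epsilon>)))
        \<in> O[at_right 0](\<lambda>\<epsilon>. ((1 - p) * ln (inverse \<epsilon>)) powr (1 / (1 - p)))) \<and>
    (p = 1 \<longrightarrow>
      (\<forall>\<epsilon>>0. (\<exists>k. crosses \<delta> \<epsilon> k) \<longrightarrow>
         real (card (Shat \<epsilon>)) \<le> exp (\<kappa>0 / (2 * \<mu>\<^sub>c) * ln (\<delta> 0 / \<epsilon>) - \<kappa>2)) \<and>
      (\<lambda>\<epsilon>. exp (\<kappa>0 / (2 * \<mu>\<^sub>c) * ln (\<delta> 0 / \<epsilon>) - \<kappa>2))
        \<in> O[at_right 0](\<lambda>\<epsilon>. \<epsilon> powr (- (\<kappa>0 / (2 * \<mu>\<^sub>c)))) \<and>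
      (\<lambda>\<epsilon>. real (card (Shat \<epsilon>))) \<in> O[at_right 0](\<lambda>\<epsilon>. \<epsilon> powr (- (\<kappa>0 / (2 * \<mu>\<^sub>c)))))"
proof -
  interpret trust_region_run f g \<eta>1 \<eta>2 \<gamma>1 \<gamma>2 \<gamma>3 \<gamma>4 \<kappa>mdc \<alpha> \<beta> x \<Delta> B t s
    by (rule run)
  have S_below: "{i \<in> S. i < k} = {i. \<eta>1 \<le> \<rho> i \<and> i < k}" for k
    by (auto simp: S_eq)
  have "mnorm (B j) \<le> \<mu> * (1 + rpow (real (card {i. \<eta>1 \<le> \<rho> i \<and> i < k})) p)" if "j \<le> k" for j k
  proof -
    have "mnorm (B j) \<le> Max ((\<lambda>j. mnorm (B j)) ` {0..k})"
      using that by (intro Max_ge) auto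
    also note B_growth[of k]
    finally show ?thesis
      by (simp only: S_below)
  qed
  then interpret strongly_convex_trust_region_run
      f g \<eta>1 \<eta>2 \<gamma>1 \<gamma>2 \<gamma>3 \<gamma>4 \<kappa>mdc \<alpha> \<beta> x \<Delta> B t s L f_low \<mu>\<^sub>c \<mu> p
    using L model_error f_low mu_c strongly_convex mu by unfold_locales auto
  \<comment> \<open>One success suffices for a positive initial gap, and then the constants are positive.\<close>
  obtain i where "i \<in> S"
    using S_infinite by (metis ex_in_conv finite.emptyI)
  then have gap_i: "0 < f (x i) - f_low"
    using gap_pos_of_successful[of i] by (simp add: S_eq)
  then have \<delta>0: "0 < \<delta> 0"
    using f_iterates_antimono[of 0 i] by (simp add: delta)
  have amin: "0 < amin"
    by (rule amin_pos_of_gap_pos[OF gap_i])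
  define a where "a = \<kappa>0 / (2 * \<mu>\<^sub>c)"
  have a_eq: "a = psi L \<beta> (2 * \<mu>) / (2 * \<mu>\<^sub>c * \<eta>1 * \<kappa>mdc * amin)"
    by (simp add: a_def kappa0 mult_ac)
  have a: "0 < a"
    unfolding a_eq using amin mu_c \<eta> \<kappa>mdc psi_pos[OF L, of "2 * \<mu>" \<beta>] mu by simp
  define bound where "bound \<epsilon> =
     (if p = 0 then a * ln (\<delta> 0 / \<epsilon>)
      else if p = 1 then exp (a * ln (\<delta> 0 / \<epsilon>) - \<kappa>2)
      else ((1 - p) * (a * ln (\<delta> 0 / \<epsilon>) - \<kappa>2) + 1) powr (1 / (1 - p)))" for \<epsilon>
  have count: "real (card {i \<in> S. i < k}) \<le> bound \<epsilon>" if "0 < \<epsilon>" "\<epsilon> < \<delta> k" for k \<epsilon>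
  proof -
    have W: "weight_sum L \<beta> \<mu> p (card {i \<in> S. i < k}) \<le> a * ln (\<delta> 0 / \<epsilon>)"
      using weight_sum_le_ln[of \<epsilon> k] that by (simp add: S_below delta a_eq)
    consider "p = 0" | "0 < p" "p < 1" | "p = 1"
      using p by linarith
    then show ?thesis
    proof cases
      case 1
      then show ?thesis
        using W weight_sum_const[OF L mu, of \<beta>] by (simp add: bound_def)
    next
      case 2
      then show ?thesis
        using count_le_powr[OF L mu 2 W] by (simp add: bound_def kappa2)
    next
      case 3
      then show ?thesis
        using count_le_exp[OF L mu W[unfolded 3]] by (simp add: bound_def kappa2)
    qed
  qed
  \<comment> \<open>If the gap stayed above \<open>\<epsilon>\<close>, the number of successes would be bounded.\<close>
  have crossing: "\<exists>k. crosses \<delta> \<epsilon> k" if \<epsilon>: "0 < \<epsilon>" "\<epsilon> < \<delta> 0" for \<epsilon>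
  proof -
    obtain N :: nat where N: "bound \<epsilon> < real N"
      using reals_Archimedean2 by blast
    obtain k where "N \<le> card {i \<in> S. i < k}"
      using infinite_card_below_unbounded[OF S_infinite] by blast
    then have "\<not> \<epsilon> < \<delta> k"
      using count[OF \<epsilon>(1), of k] N by linarith
    then show ?thesis
      using crosses_exists[of \<epsilon> \<delta> k] \<epsilon>(2) by simp
  qed
  have card_le: "real (card (Shat \<epsilon>)) \<le> bound \<epsilon>" if "0 < \<epsilon>" "\<exists>k. crosses \<delta> \<epsilon> k" for \<epsilon>
  proof -
    have "crosses \<delta> \<epsilon> (khat \<delta> \<epsilon>)"
      using that(2) unfolding khat_def by (rule LeastI_ex)
    then show ?thesis
      using count[OF that(1)] by (simp add: crosses_def Shat)
  qed
  have "eventually (\<lambda>\<epsilon>. \<epsilon> < \<delta> 0) (at_right 0)"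
    by (rule order_tendstoD(2)[OF tendsto_ident_at \<delta>0])
  then have "eventually (\<lambda>\<epsilon>. real (card (Shat \<epsilon>)) \<le> bound \<epsilon>) (at_right 0)"
    using eventually_at_right_less[of 0]
  proof eventually_elim
    case (elim \<epsilon>)
    then show ?case
      using \<delta>0 crossing card_le by blast
  qed
  then have card_bigo: "(\<lambda>\<epsilon>. real (card (Shat \<epsilon>))) \<in> O[at_right 0](h)"
    if "bound \<in> O[at_right 0](h)" for h :: "real \<Rightarrow> real"
    by (intro landau_o.big_trans[OF bigoI[of _ 1] that]) (auto elim!: eventually_mono)
  show ?thesis
  proof (intro conjI allI impI; (elim conjE)?)
    fix \<epsilon> assume "0 < \<epsilon>" "\<epsilon> < \<delta> 0"
    then show "\<exists>k. crosses \<delta> \<epsilon> k"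
      by (rule crossing)
  next
    assume "p = 0"
    then have b: "bound = (\<lambda>\<epsilon>. \<kappa>0 / (2 * \<mu>\<^sub>c) * ln (\<delta> 0 / \<epsilon>))"
      by (simp add: bound_def a_def fun_eq_iff)
    show "real (card (Shat \<epsilon>)) \<le> \<kappa>0 / (2 * \<mu>\<^sub>c) * ln (\<delta> 0 / \<epsilon>)"
      if "0 < \<epsilon>" "\<exists>k. crosses \<delta> \<epsilon> k" for \<epsilon>
      using card_le[OF that] by (simp add: b)
    show *: "(\<lambda>\<epsilon>. \<kappa>0 / (2 * \<mu>\<^sub>c) * ln (\<delta> 0 / \<epsilon>)) \<in> O[at_right 0](\<lambda>\<epsilon>. ln (inverse \<epsilon>))"
      using affine_ln_bigo[OF \<delta>0, of a 0] by (simp add: a_def)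
    show "(\<lambda>\<epsilon>. real (card (Shat \<epsilon>))) \<in> O[at_right 0](\<lambda>\<epsilon>. ln (inverse \<epsilon>))"
      using * by (intro card_bigo) (simp add: b)
  next
    assume p': "0 < p" "p < 1"
    then have b: "bound = (\<lambda>\<epsilon>. ((1 - p) * (\<kappa>0 / (2 * \<mu>\<^sub>c) * ln (\<delta> 0 / \<epsilon>) - \<kappa>2) + 1)
        powr (1 / (1 - p)))"
      by (simp add: bound_def a_def fun_eq_iff)
    show "real (card (Shat \<epsilon>))
        \<le> ((1 - p) * (\<kappa>0 / (2 * \<mu>\<^sub>c) * ln (\<delta> 0 / \<epsilon>) - \<kappa>2) + 1) powr (1 / (1 - p))"
      if "0 < \<epsilon>" "\<exists>k. crosses \<delta> \<epsilon> k" for \<epsilon>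
      using card_le[OF that] by (simp add: b)
    show *: "(\<lambda>\<epsilon>. ((1 - p) * (\<kappa>0 / (2 * \<mu>\<^sub>c) * ln (\<delta> 0 / \<epsilon>) - \<kappa>2) + 1) powr (1 / (1 - p)))
        \<in> O[at_right 0](\<lambda>\<epsilon>. ((1 - p) * ln (inverse \<epsilon>)) powr (1 / (1 - p)))"
      using affine_ln_powr_bigo[OF \<delta>0 a, of "1 - p" \<kappa>2] p' by (simp add: a_def)
    show "(\<lambda>\<epsilon>. real (card (Shat \<epsilon>)))
        \<in> O[at_right 0](\<lambda>\<epsilon>. ((1 - p) * ln (inverse \<epsilon>)) powr (1 / (1 - p)))"
      using * by (intro card_bigo) (simp add: b)
  next
    assume p': "p = 1"
    then have b: "bound = (\<lambda>\<epsilon>. exp (\<kappa>0 / (2 * \<mu>\<^sub>c) * ln (\<delta> 0 / \<epsilon>) - \<kappa>2))"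
      by (simp add: bound_def a_def fun_eq_iff)
    show "real (card (Shat \<epsilon>)) \<le> exp (\<kappa>0 / (2 * \<mu>\<^sub>c) * ln (\<delta> 0 / \<epsilon>) - \<kappa>2)"
      if "0 < \<epsilon>" "\<exists>k. crosses \<delta> \<epsilon> k" for \<epsilon>
      using card_le[OF that] by (simp add: b)
    show *: "(\<lambda>\<epsilon>. exp (\<kappa>0 / (2 * \<mu>\<^sub>c) * ln (\<delta> 0 / \<epsilon>) - \<kappa>2))
        \<in> O[at_right 0](\<lambda>\<epsilon>. \<epsilon> powr (- (\<kappa>0 / (2 * \<mu>\<^sub>c))))"
      using exp_ln_bigo[OF \<delta>0, of a \<kappa>2] by (simp add: a_def)
    show "(\<lambda>\<epsilon>. real (card (Shat \<epsilon>))) \<in> O[at_right 0](\<lambda>\<epsilon>. \<epsilon> powr (- (\<kappa>0 / (2 * \<mu>\<^sub>c))))"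
      using * by (intro card_bigo) (simp add: b)
  qed
qed

end
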